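(* Let $y=\mu+u$ with $\mu\in\mathbb{R}^n$, $u\sim N(0,\sigma^2I_n)$, $\sigma>0$, and let $\hat\sigma^2$ be a variance estimator as described in the context. Let $M_0,M_1$ be two candidate models (nonempty subsets of $\{1,\dots,p\}$ such that $X_{M_0}$ and $X_{M_1}$ have full column rank) with $1\in M_1$ and $1\notin M_0$, and let $\hat M$ be any (data-driven) model selection procedure that chooses only between $M_0$ and $M_1$. Let $0<\alpha<1$. Define the model-dependent coverage target $b_{\hat M}$ by $b_{M_1}=\beta_{1\cdot M_1}$ and $b_{M_0}=0$, and define $$I_{\hat M}=\begin{cases}[\hat\beta_{1\cdot M_1}-k_N\hat\sigma_{1\cdot M_1},\ \hat\beta_{1\cdot M_1}+k_N\hat\sigma_{1\cdot M_1}] & \text{if }\hat M=M_1,\\ \{0\} & \text{if }\hat M=M_0,\end{cases}$$ where $k_N$ is chosen so that $\mathbb{P}_{\mu,\sigma}\bigl(\beta_{1\cdot M_1}\in[\hat\beta_{1\cdot M_1}-k_N\hat\sigma_{1\cdot M_1},\hat\beta_{1\cdot M_1}+k_N\hat\sigma_{1\cdot M_1}]\bigr)=1-\alpha$, that is, $k_N$ is the $(1-\alpha/2)$-quantile of the standard normal distribution in the known-variance case and of the $t$-distribution with $r$ degrees of freedom in the unknown-variance case. Then, for all $\mu\in\mathbb{R}^n$ and $\sigma>0$, $$\mathbb{P}_{\mu,\sigma}\bigl(b_{\hat M}\in I_{\hat M}\bigr)\ \ge\ 1-\alpha .$$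
   Context: $X$ is a fixed $n\times p$ matrix with columns $X_1,\dots,X_p$ ($p>n$ is allowed). For $M\subseteq\{1,\dots,p\}$ nonempty, $X_M$ is the matrix of those columns of $X$ whose indices lie in $M$; full column rank means that the rank of $X_M$ equals $|M|$ with $1\le|M|\le n$. Define $\beta_M=(X_M'X_M)^{-1}X_M'\mu$ and $\hat\beta_M=(X_M'X_M)^{-1}X_M'y$ (prime denotes transpose). For $1\in M$, $\beta_{1\cdot M}$ and $\hat\beta_{1\cdot M}$ denote the components of $\beta_M$ and $\hat\beta_M$ corresponding to the regressor $X_1$, and $\hat\sigma_{1\cdot M}\ge0$ is defined by $\hat\sigma_{1\cdot M}^2=\hat\sigma^2 d_{1\cdot M}$, where $d_{1\cdot M}$ is the diagonal element of $(X_M'X_M)^{-1}$ corresponding to $X_1$. The models need not be correct, i.e. $\mu$ need not lie in the column space of $X_{M_0}$ or $X_{M_1}$. The variance estimator $\hat\sigma^2$ ($\hat\sigma\ge0$) is independent of the collection $\{\hat\beta_{M_0},\hat\beta_{M_1}\}$, and either $\hat\sigma^2\sim\sigma^2\chi^2_r/r$ for some integer $r\ge1$ (unknown-variance case) or $\hat\sigma^2=\sigma^2$ (known-variance case). $\mathbb{P}_{\mu,\sigma}$ denotes the joint distribution of $y$ and $\hat\sigma$. A model selection procedure is a data-driven rule, i.e. a (measurable) function of the data with values in $\{M_0,M_1\}$. *)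

theory Defs
  imports
    "HOL-Probability.Probability"
    "Jordan_Normal_Form.DL_Submatrix"
    "Jordan_Normal_Form.DL_Rank"
    "Jordan_Normal_Form.Gauss_Jordan_Elimination"
begin

section \<open>Submodels and least squares\<close>

text \<open>
  Columns are numbered from 0, so the regressor of interest \<open>X\<^sub>1\<close> is column \<open>0\<close> of \<open>X\<close>.
  Since \<open>submatrix\<close> keeps the columns in increasing order, it is also column \<open>0\<close> of \<open>X\<^sub>M\<close>
  whenever \<open>0 \<in> M\<close>.
\<close>

definition submodel :: "real mat \<Rightarrow> nat set \<Rightarrow> real mat" where
  "submodel X M = submatrix X UNIV M"

definition full_column_rank :: "real mat \<Rightarrow> nat set \<Rightarrow> bool" where
  "full_column_rank X M \<longleftrightarrow>
     1 \<le> card M \<and> card M \<le> dim_row X \<and> vec_space.rank (dim_row X) (submodel X M) = card M"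

text \<open>
  \<open>mat_inverse\<close> returns \<open>None\<close> on singular matrices; under full column rank the Gram matrix is
  invertible.
\<close>

definition inv_gram :: "real mat \<Rightarrow> nat set \<Rightarrow> real mat" where
  "inv_gram X M = the (mat_inverse (transpose_mat (submodel X M) * submodel X M))"

text \<open>
  The same linear map gives \<open>\<beta>\<^sub>M\<close> when applied to \<open>\<mu>\<close> and the least-squares estimator when
  applied to \<open>y\<close>.
\<close>

definition ls_coeff :: "real mat \<Rightarrow> nat set \<Rightarrow> real vec \<Rightarrow> real vec" where
  "ls_coeff X M v = inv_gram X M *\<^sub>v (transpose_mat (submodel X M) *\<^sub>v v)"

definition ls_coeff1 :: "real mat \<Rightarrow> nat set \<Rightarrow> real vec \<Rightarrow> real" where
  "ls_coeff1 X M v = vec_index (ls_coeff X M v) 0"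

definition std_err1 :: "real mat \<Rightarrow> nat set \<Rightarrow> real \<Rightarrow> real" where
  "std_err1 X M s = sqrt (s\<^sup>2 * inv_gram X M $$ (0, 0))"

definition naive_interval :: "real mat \<Rightarrow> nat set \<Rightarrow> real \<Rightarrow> real vec \<Rightarrow> real \<Rightarrow> real set" where
  "naive_interval X M k y s =
     {ls_coeff1 X M y - k * std_err1 X M s .. ls_coeff1 X M y + k * std_err1 X M s}"


section \<open>Distributions and quantiles\<close>

definition chi_square :: "nat \<Rightarrow> real measure" where
  "chi_square r =
     distr (\<Pi>\<^sub>M i\<in>{..<r}. std_normal_distribution) borel (\<lambda>z. \<Sum>i<r. (z i)\<^sup>2)"

definition student_t :: "nat \<Rightarrow> real measure" where
  "student_t r =
     distr (std_normal_distribution \<Otimes>\<^sub>M chi_square r) borel (\<lambda>(z, v). z / sqrt (v / real r))"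

definition quantile :: "real measure \<Rightarrow> real \<Rightarrow> real" where
  "quantile N q = Inf {x. q \<le> cdf N x}"


section \<open>The sampling model\<close>

datatype variance_case = Known_Variance | Unknown_Variance nat

definition normal_or_t :: "variance_case \<Rightarrow> real measure" where
  "normal_or_t c =
     (case c of Known_Variance \<Rightarrow> std_normal_distribution | Unknown_Variance r \<Rightarrow> student_t r)"

text \<open>
  Vectors of type \<open>real vec\<close> carry no measurable structure, so the response is represented by
  its coordinate function in the product space; \<open>vec n y\<close> is the corresponding vector.
\<close>

definition data_space :: "nat \<Rightarrow> ((nat \<Rightarrow> real) \<times> real) measure" where
  "data_space n = (\<Pi>\<^sub>M i\<in>{..<n}. borel) \<Otimes>\<^sub>M borel"

definition coords :: "real vec \<Rightarrow> nat \<Rightarrow> real" where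
  "coords v = (\<lambda>i\<in>{..<dim_vec v}. vec_index v i)"

text \<open>
  The library constant \<open>indep_var\<close> requires both random variables to have the same type; this
  is its heterogeneous form.
\<close>

definition indep_rv :: "'w measure \<Rightarrow> 'a measure \<Rightarrow> ('w \<Rightarrow> 'a) \<Rightarrow> 'b measure \<Rightarrow> ('w \<Rightarrow> 'b) \<Rightarrow> bool" where
  "indep_rv P S A T B \<longleftrightarrow>
     A \<in> measurable P S \<and> B \<in> measurable P T \<and>
     prob_space.indep_set P {A -` E \<inter> space P | E. E \<in> sets S} {B -` E \<inter> space P | E. E \<in> sets T}"

text \<open>
  \<open>P\<close> is the joint law of the pair (response, estimator of \<open>\<sigma>\<close>).  The error \<open>u = y - \<mu>\<close> has law
  \<open>N(0, \<sigma>\<^sup>2 I\<^sub>n)\<close>, the product of \<open>n\<close> copies of \<open>N(0, \<sigma>\<^sup>2)\<close>; note that \<open>normal_density\<close>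
  takes the standard deviation, not the variance.
\<close>

definition sampling_law ::
  "real mat \<Rightarrow> nat set \<Rightarrow> nat set \<Rightarrow> variance_case \<Rightarrow> real vec \<Rightarrow> real
     \<Rightarrow> ((nat \<Rightarrow> real) \<times> real) measure \<Rightarrow> bool" where
  "sampling_law X M0 M1 c \<mu> \<sigma> P \<longleftrightarrow>
     (let n = dim_row X in
      prob_space P \<and> sets P = sets (data_space n) \<and>
      distr P (\<Pi>\<^sub>M i\<in>{..<n}. borel) (\<lambda>(y, s). \<lambda>i\<in>{..<n}. y i - vec_index \<mu> i) =
        (\<Pi>\<^sub>M i\<in>{..<n}. density lborel (normal_density 0 \<sigma>)) \<and>
      (AE (y, s) in P. 0 \<le> s) \<and>
      indep_rv P
        borel (\<lambda>(y, s). s\<^sup>2)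
        ((\<Pi>\<^sub>M i\<in>{..<card M0}. borel) \<Otimes>\<^sub>M (\<Pi>\<^sub>M i\<in>{..<card M1}. borel))
        (\<lambda>(y, s). (coords (ls_coeff X M0 (vec n y)), coords (ls_coeff X M1 (vec n y)))) \<and>
      (case c of
         Known_Variance \<Rightarrow> (AE (y, s) in P. s\<^sup>2 = \<sigma>\<^sup>2)
       | Unknown_Variance r \<Rightarrow>
           1 \<le> r \<and>
           distr P borel (\<lambda>(y, s). s\<^sup>2) =
             distr (chi_square r) borel (\<lambda>v. \<sigma>\<^sup>2 * v / real r)))"


section \<open>Model-dependent target and interval\<close>

definition target :: "real mat \<Rightarrow> nat set \<Rightarrow> real vec \<Rightarrow> nat set \<Rightarrow> real" where
  "target X M1 \<mu> M = (if M = M1 then ls_coeff1 X M1 \<mu> else 0)"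

definition post_interval ::
  "real mat \<Rightarrow> nat set \<Rightarrow> real \<Rightarrow> real vec \<Rightarrow> real \<Rightarrow> nat set \<Rightarrow> real set" where
  "post_interval X M1 k y s M = (if M = M1 then naive_interval X M1 k y s else {0})"

end

theory Submission
  imports Defs
begin

text \<open>
  When \<open>M\<^sub>0\<close> is selected, target and interval are both \<open>0\<close> and coverage is certain, so for
  every selection rule the event of interest contains the event that the naive interval for
  the coefficient of \<open>X\<^sub>1\<close> in \<open>M\<^sub>1\<close> covers.  The studentized estimator in the fixed model \<open>M\<^sub>1\<close> is standard normal or
  \<open>t\<close>-distributed, whether or not \<open>\<mu>\<close> lies in the column space.
  By symmetry of these laws its absolute value is at most the \<open>(1 - \<alpha>/2)\<close>-quantile with
  probability at least \<open>1 - \<alpha>\<close>.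
\<close>

section \<open>Linear algebra of the least-squares coefficient\<close>

text \<open>A nonzero kernel vector is a linear dependence among the columns. The rank is computed
  from the set of columns, so repeated columns have to be excluded first: a maximal independent
  subset has \<open>m\<close> elements, which forces the \<open>m\<close> listed columns to be
  distinct.\<close>

lemma full_column_rank_mult_vec_eq_0:
  fixes A :: "real mat"
  assumes A: "A \<in> carrier_mat n m" and rank: "vec_space.rank n A = m"
    and v: "v \<in> carrier_vec m" "A *\<^sub>v v = 0\<^sub>v n"
  shows "v = 0\<^sub>v m"
proof (rule ccontr)
  assume nz: "v \<noteq> 0\<^sub>v m"
  interpret vec_space "TYPE(real)" n .
  obtain S where S: "maximal S (\<lambda>T. T \<subseteq> set (cols A) \<and> lin_indpt T)"
    using maximal_exists[of "(\<lambda>T. T \<subseteq> set (cols A) \<and> lin_indpt T)" "card (set (cols A))" "{}"]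
    by (meson List.finite_set card_mono empty_iff empty_subsetI finite_lin_indpt2 rev_finite_subset)
  then have "card S \<le> card (set (cols A))" by (simp add: card_mono maximal_def)
  moreover have "card S = m" using rank_card_indpt[OF A S] rank by simp
  ultimately have "card (set (cols A)) = length (cols A)"
    using card_length[of "cols A"] A by simp
  then have dist: "distinct (cols A)" by (rule card_distinct)
  show False
    using lin_depI[OF A v(1) nz v(2) dist] full_rank_lin_indpt[OF A rank dist] by blast
qed

lemma submodel_carrier:
  assumes "X \<in> carrier_mat n p" "M \<subseteq> {..<p}"
  shows "submodel X M \<in> carrier_mat n (card M)"
proof -
  have "{j. j < p \<and> j \<in> M} = M" using assms(2) by auto
  then show ?thesis
    using assms(1) by (intro carrier_matI) (simp_all add: submodel_def dim_submatrix)
qed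

text \<open>Justifies the use of \<open>the\<close> in \<open>inv_gram\<close>. If \<open>v\<close>
  is in the kernel of the Gram matrix, then the squared norm of \<open>A *\<^sub>v v\<close> is
  zero, so \<open>v\<close> is in the kernel of \<open>A\<close>, which is trivial by full column
  rank.\<close>

lemma inv_gram_inverse:
  assumes X: "X \<in> carrier_mat n p" and M: "M \<subseteq> {..<p}" "full_column_rank X M"
  defines "A \<equiv> submodel X M"
  shows "inv_gram X M \<in> carrier_mat (card M) (card M)"
    and "inv_gram X M * (transpose_mat A * A) = 1\<^sub>m (card M)"
proof -
  let ?m = "card M" and ?G = "transpose_mat A * A"
  have A: "A \<in> carrier_mat n ?m" unfolding A_def by (rule submodel_carrier) fact+
  have rank: "vec_space.rank n A = ?m"
    using M(2) X by (simp add: full_column_rank_def A_def)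
  have G: "?G \<in> carrier_mat ?m ?m" using A by simp
  have "det ?G \<noteq> 0"
  proof
    assume "det ?G = 0"
    then obtain v where v: "v \<in> carrier_vec ?m" "v \<noteq> 0\<^sub>v ?m" "?G *\<^sub>v v = 0\<^sub>v ?m"
      using det_0_iff_vec_prod_zero_field[OF G] by blast
    have Av: "A *\<^sub>v v \<in> carrier_vec n" using A v by simp
    have "(A *\<^sub>v v) \<bullet> (A *\<^sub>v v) = v \<bullet> (transpose_mat A *\<^sub>v (A *\<^sub>v v))"
      using transpose_vec_mult_scalar[OF A v(1) Av] Av v(1) A
      by (metis mult_mat_vec_carrier comm_scalar_prod transpose_carrier_mat)
    also have "\<dots> = v \<bullet> (?G *\<^sub>v v)"
      using A v by (subst assoc_mult_mat_vec) auto
    also have "\<dots> = 0" using v by simp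
    finally have "A *\<^sub>v v = 0\<^sub>v n"
      using conjugate_square_eq_0_vec[OF Av] by (simp)
    then show False using full_column_rank_mult_vec_eq_0[OF A rank v(1)] v(2) by blast
  qed
  \<comment> \<open>The unit value \<open>()\<close> fills the record-extension argument of the
    matrix ring in which invertibility is expressed.\<close>
  then obtain B where B: "mat_inverse ?G = Some B"
    using mat_inverse(1)[OF G, of "()"] det_non_zero_imp_unit[OF G, of "()"]
    by (cases "mat_inverse ?G") auto
  from B mat_inverse(2)[OF G B]
  show "inv_gram X M \<in> carrier_mat ?m ?m" "inv_gram X M * ?G = 1\<^sub>m ?m"
    by (auto simp: inv_gram_def A_def)
qed

text \<open>The weights \<open>a\<close> are row 0 of \<open>C\<close>, the inverse Gram matrix
  times the transposed design. Since \<open>C * A\<close> is the identity, that row cannot vanish,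
  and \<open>C\<close> times its transpose collapses to the transposed inverse Gram matrix, whose
  entry (0,0) is the squared norm of the row.\<close>

lemma ls_coeff1_linear:
  assumes X: "X \<in> carrier_mat n p" and M: "M \<subseteq> {..<p}" "full_column_rank X M"
  obtains a where "\<And>v. v \<in> carrier_vec n \<Longrightarrow> ls_coeff1 X M v = (\<Sum>i<n. a i * vec_index v i)"
    and "(\<Sum>i<n. (a i)\<^sup>2) = inv_gram X M $$ (0, 0)" and "inv_gram X M $$ (0, 0) > 0"
proof -
  define A where "A = submodel X M"
  define B where "B = inv_gram X M"
  let ?m = "card M"
  define C where "C = B * transpose_mat A"
  have m: "0 < ?m" using M(2) by (simp add: full_column_rank_def)
  have A: "A \<in> carrier_mat n ?m" unfolding A_def by (rule submodel_carrier) fact+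
  have B: "B \<in> carrier_mat ?m ?m" and BG: "B * (transpose_mat A * A) = 1\<^sub>m ?m"
    using inv_gram_inverse[OF assms] by (auto simp: A_def B_def)
  have At: "transpose_mat A \<in> carrier_mat ?m n" using A by simp
  have C: "C \<in> carrier_mat ?m n" using B At by (simp add: C_def)
  have CA: "C * A = 1\<^sub>m ?m" unfolding C_def using BG B A At by (simp add: assoc_mult_mat[OF B At A])
  have "C * transpose_mat C = C * (A * transpose_mat B)"
    using B At A by (simp add: C_def transpose_mult[OF B At])
  also have "\<dots> = transpose_mat B"
    using CA C A B by (subst assoc_mult_mat[symmetric, OF C A, of _ ?m]) auto
  finally have CC: "C * transpose_mat C = transpose_mat B" .
  have sq: "(\<Sum>i<n. (C $$ (0, i))\<^sup>2) = B $$ (0, 0)"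
  proof -
    \<comment> \<open>A diagonal entry is the same in \<open>B\<close> and in its transpose.\<close>
    have "B $$ (0, 0) = (C * transpose_mat C) $$ (0, 0)" unfolding CC using B m by simp
    also have "\<dots> = (\<Sum>i<n. (C $$ (0, i))\<^sup>2)"
      using C m by (simp add: scalar_prod_def power2_eq_square atLeast0LessThan)
    finally show ?thesis ..
  qed
  have "(\<Sum>i<n. (C $$ (0, i))\<^sup>2) > 0"
  proof (rule ccontr)
    assume "\<not> ?thesis"
    then have "(\<Sum>i<n. (C $$ (0, i))\<^sup>2) = 0" by (simp add: sum_nonneg order_antisym not_less)
    then have "\<And>i. i < n \<Longrightarrow> C $$ (0, i) = 0" by (subst (asm) sum_nonneg_eq_0_iff) auto
    then have "(C * A) $$ (0, 0) = 0" using C A m by (simp add: scalar_prod_def)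
    then show False using CA m by simp
  qed
  moreover have "ls_coeff1 X M v = (\<Sum>i<n. C $$ (0, i) * vec_index v i)" if v: "v \<in> carrier_vec n" for v
  proof -
    have "ls_coeff X M v = C *\<^sub>v v"
      unfolding ls_coeff_def C_def A_def[symmetric] B_def[symmetric]
      by (rule assoc_mult_mat_vec[symmetric, OF B At v])
    then show ?thesis
      using C v m by (simp add: ls_coeff1_def scalar_prod_def atLeast0LessThan)
  qed
  ultimately show thesis using that[of "\<lambda>i. C $$ (0, i)"] sq by (simp add: B_def)
qed

section \<open>Normal law of linear combinations\<close>

lemma distributed_lborel_iff:
  "distributed M lborel f d \<longleftrightarrow>
    f \<in> borel_measurable M \<and> d \<in> borel_measurable borel \<and> distr M borel f = density lborel d"
proof -
  have "distr M lborel f = distr M borel f" by (rule distr_cong) simp_all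
  then show ?thesis by (auto simp: distributed_def)
qed

text \<open>Coordinates of a product measure are independent, scaling multiplies the standard
  deviation by the absolute weight, and variances of independent normal summands add up. Positivity
  of the sum of squares keeps the resulting normal law nondegenerate.\<close>

lemma distr_linear_combination_normal:
  fixes a :: "'i \<Rightarrow> real"
  assumes I: "finite I" and \<sigma>: "0 < \<sigma>" and a: "0 < (\<Sum>i\<in>I. (a i)\<^sup>2)"
  shows "distr (\<Pi>\<^sub>M i\<in>I. density lborel (normal_density 0 \<sigma>)) borel (\<lambda>u. \<Sum>i\<in>I. a i * u i) =
    density lborel (normal_density 0 (\<sigma> * sqrt (\<Sum>i\<in>I. (a i)\<^sup>2)))"
proof -
  define N where "N = density lborel (normal_density 0 \<sigma>)"
  define M where "M = (\<Pi>\<^sub>M i\<in>I. N)"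
  have N: "prob_space N" unfolding N_def by (rule prob_space_normal_density) fact
  interpret prob_space M unfolding M_def by (rule prob_space_PiM) (rule N)
  have sN: "sets N = sets borel" by (simp add: N_def)
  have coord[measurable]: "(\<lambda>u. u i) \<in> borel_measurable M" if "i \<in> I" for i
    unfolding M_def measurable_cong_sets[OF refl sN[symmetric]]
    by (rule measurable_component_singleton) fact
  have comp: "distr M borel (\<lambda>u. u i) = N" if "i \<in> I" for i
    using distr_PiM_component[of I "\<lambda>_. N" i] N that sN
    by (simp add: M_def cong: distr_cong)
  \<comment> \<open>\<open>sum_indep_normal\<close> does not admit degenerate summands, so zero coefficients are dropped.\<close>
  define J where "J = {i\<in>I. a i \<noteq> 0}"
  have J: "finite J" "J \<subseteq> I" using I by (auto simp: J_def)
  have sumJ: "(\<Sum>i\<in>J. g i) = (\<Sum>i\<in>I. g i)" if "\<And>i. a i = 0 \<Longrightarrow> g i = 0" for g :: "'i \<Rightarrow> real"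
    using I that by (intro sum.mono_neutral_left) (auto simp: J_def)
  have neJ: "J \<noteq> {}"
  proof
    assume "J = {}"
    then have "(\<Sum>i\<in>I. (a i)\<^sup>2) = 0" using sumJ[of "\<lambda>i. (a i)\<^sup>2"] by simp
    with a show False by simp
  qed
  have "indep_vars (\<lambda>_. borel) (\<lambda>i u. u i) I"
  proof (subst indep_vars_iff_distr_eq_PiM')
    show "I \<noteq> {}" using neJ J by auto
    \<comment> \<open>Points of the product space are already extensional on \<open>I\<close>, so
      the joint law of the coordinates is \<open>M\<close> itself.\<close>
    have "distr M (\<Pi>\<^sub>M i\<in>I. borel) (\<lambda>u. \<lambda>i\<in>I. u i) = distr M M (\<lambda>u. u)"
    proof (rule distr_cong)
      show "sets (\<Pi>\<^sub>M i\<in>I. borel) = sets M" unfolding M_def by (intro sets_PiM_cong) (simp_all add: sN)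
      fix u assume "u \<in> space M"
      then show "(\<lambda>i\<in>I. u i) = u" by (auto simp: M_def space_PiM extensional_restrict PiE_def)
    qed simp
    also have "\<dots> = (\<Pi>\<^sub>M i\<in>I. distr M borel (\<lambda>u. u i))"
      by (simp add: distr_id) (simp add: M_def, intro PiM_cong, auto simp: comp[unfolded M_def])
    finally show "distr M (\<Pi>\<^sub>M i\<in>I. borel) (\<lambda>u. \<lambda>i\<in>I. u i) = (\<Pi>\<^sub>M i\<in>I. distr M borel (\<lambda>u. u i))" .
  qed auto
  then have "indep_vars (\<lambda>_. borel) (\<lambda>i u. u i) J"
    by (rule indep_vars_subset) fact
  then have ind: "indep_vars (\<lambda>_. borel) (\<lambda>i u. a i * u i) J"
    by (rule indep_vars_compose2[where Y="\<lambda>i x. a i * x"]) simp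
  have "distributed M lborel (\<lambda>u. a i * u i) (normal_density 0 (\<bar>a i\<bar> * \<sigma>))" if i: "i \<in> J" for i
  proof -
    have "distributed M lborel (\<lambda>u. u i) (normal_density 0 \<sigma>)"
      using comp[of i] i J by (auto simp: distributed_lborel_iff N_def)
    from normal_density_affine[OF this \<sigma>, of "a i" 0] i show ?thesis by (simp add: J_def)
  qed
  then have "distributed M lborel (\<lambda>u. \<Sum>i\<in>J. a i * u i)
      (normal_density (\<Sum>i\<in>J. 0) (sqrt (\<Sum>i\<in>J. (\<bar>a i\<bar> * \<sigma>)\<^sup>2)))"
    using J neJ ind \<sigma> by (intro sum_indep_normal) (auto simp: J_def)
  moreover have "(\<lambda>u. \<Sum>i\<in>J. a i * u i) = (\<lambda>u. \<Sum>i\<in>I. a i * u i)"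
    by (intro ext sumJ) simp
  moreover have "sqrt (\<Sum>i\<in>J. (\<bar>a i\<bar> * \<sigma>)\<^sup>2) = \<sigma> * sqrt (\<Sum>i\<in>I. (a i)\<^sup>2)"
    using \<sigma> by (subst sumJ) (auto simp: power_mult_distrib real_sqrt_mult simp flip: sum_distrib_right)
  ultimately have "distributed M lborel (\<lambda>u. \<Sum>i\<in>I. a i * u i)
      (normal_density 0 (\<sigma> * sqrt (\<Sum>i\<in>I. (a i)\<^sup>2)))" by simp
  then show ?thesis by (simp add: distributed_lborel_iff M_def N_def)
qed

section \<open>Quantiles and symmetry of the normal and t laws\<close>

text \<open>The upper tail beyond the quantile has mass at most \<alpha>/2, and reflection carries
  this bound over to the lower tail.\<close>

lemma symmetric_quantile_coverage:
  assumes N: "real_distribution N" and sym: "distr N borel uminus = N" and \<alpha>: "0 < \<alpha>" "\<alpha> < 1"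
  shows "1 - \<alpha> \<le> measure N {x. \<bar>x\<bar> \<le> quantile N (1 - \<alpha> / 2)}"
proof -
  interpret real_distribution N by fact
  interpret cdf_distribution N by unfold_locales
  let ?k = "quantile N (1 - \<alpha> / 2)"
  \<comment> \<open>The infimum defining the quantile is attained: \<open>pseudoinverse\<close>
    states that a level is at most the cdf at a point iff its quantile is at most that point,
    applied here at the quantile itself.\<close>
  have "1 - \<alpha> / 2 \<le> cdf N ?k"
    using pseudoinverse[of "1 - \<alpha> / 2" ?k] \<alpha> by (simp add: quantile_def)
  then have upper: "measure N {?k<..} \<le> \<alpha> / 2"
    using prob_compl[of "{..?k}"] by (simp add: cdf_def Compl_eq_Diff_UNIV[symmetric])
  have "measure N {..<-?k} = measure (distr N borel uminus) {..<-?k}" by (simp add: sym)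
  also have "\<dots> = measure N {?k<..}"
    by (subst measure_distr) (auto intro!: arg_cong[where f="measure N"])
  finally have lower: "measure N {..<-?k} \<le> \<alpha> / 2" using upper by simp
  have "measure N (- {x. \<bar>x\<bar> \<le> ?k}) \<le> measure N ({..<-?k} \<union> {?k<..})"
    by (intro finite_measure_mono) auto
  also have "\<dots> \<le> \<alpha>" using measure_Un_le[of "{..<-?k}" N "{?k<..}"] lower upper by simp
  finally show ?thesis
    using prob_compl[of "{x. \<bar>x\<bar> \<le> ?k}"] by (simp add: Compl_eq_Diff_UNIV[symmetric])
qed

lemma std_normal_symmetric: "distr std_normal_distribution borel uminus = std_normal_distribution"
proof -
  interpret prob_space std_normal_distribution by (rule prob_space_normal_density) simp
  have "distributed std_normal_distribution lborel (\<lambda>x. x) std_normal_density"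
    by (auto simp: distributed_lborel_iff intro!: distr_id2)
  from normal_density_affine[OF this, of "-1" 0]
  have "distributed std_normal_distribution lborel uminus std_normal_density" by simp
  then show ?thesis by (simp add: distributed_lborel_iff)
qed

lemma prob_space_chi_square: "prob_space (chi_square r)"
  unfolding chi_square_def
  by (intro prob_space.prob_space_distr prob_space_PiM prob_space_normal_density) simp_all

lemma sets_chi_square [simp, measurable_cong]: "sets (chi_square r) = sets borel"
  by (simp add: chi_square_def)

text \<open>A single nonzero coordinate makes the sum of squares positive; \<open>1 \<le> r\<close>
  provides coordinate 0. This later makes the estimated standard error almost surely
  positive.\<close>

lemma AE_chi_square_pos:
  assumes "1 \<le> r"
  shows "AE v in chi_square r. 0 < v"
proof -
  have "AE z in std_normal_distribution. z \<noteq> 0"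
    using AE_lborel_singleton[of 0] by (auto simp: AE_density)
  then have "AE z in (\<Pi>\<^sub>M i\<in>{..<r}. std_normal_distribution). z 0 \<noteq> 0"
    using assms by (intro AE_PiM_component prob_space_normal_density) auto
  then have "AE z in (\<Pi>\<^sub>M i\<in>{..<r}. std_normal_distribution). 0 < (\<Sum>i<r. (z i)\<^sup>2)"
    by eventually_elim (use assms in \<open>auto intro!: sum_pos2[of _ 0]\<close>)
  then show ?thesis unfolding chi_square_def by (subst AE_distr_iff) simp_all
qed

lemma real_distribution_student_t: "real_distribution (student_t r)"
proof -
  interpret chi: prob_space "chi_square r" by (rule prob_space_chi_square)
  interpret nrm: prob_space std_normal_distribution by (rule prob_space_normal_density) simp
  interpret pair_prob_space std_normal_distribution "chi_square r" ..
  show ?thesis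
    unfolding student_t_def real_distribution_def real_distribution_axioms_def
    by (auto intro!: prob_space_distr)
qed

text \<open>Flipping the sign of the normal numerator preserves the product law and negates the
  quotient.\<close>

lemma student_t_symmetric: "distr (student_t r) borel uminus = student_t r"
proof -
  let ?N = std_normal_distribution and ?C = "chi_square r"
  have "?N \<Otimes>\<^sub>M ?C = distr ?N borel uminus \<Otimes>\<^sub>M distr ?C borel (\<lambda>v. v)"
    by (simp add: std_normal_symmetric distr_id2)
  also have "\<dots> = distr (?N \<Otimes>\<^sub>M ?C) (borel \<Otimes>\<^sub>M borel) (\<lambda>(z, v). (- z, v))"
    by (rule pair_measure_distr)
       (auto simp: distr_id2 intro!: prob_space_imp_sigma_finite prob_space_chi_square)
  finally have "student_t r =
      distr (distr (?N \<Otimes>\<^sub>M ?C) (borel \<Otimes>\<^sub>M borel) (\<lambda>(z, v). (- z, v))) borel (\<lambda>(z, v). z / sqrt (v / real r))"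
    unfolding student_t_def by simp
  also have "\<dots> = distr (?N \<Otimes>\<^sub>M ?C) borel (\<lambda>(z, v). - (z / sqrt (v / real r)))"
    by (subst distr_distr) (auto simp: comp_def case_prod_unfold)
  also have "\<dots> = distr (student_t r) borel uminus"
    unfolding student_t_def by (subst distr_distr) (auto simp: comp_def case_prod_unfold)
  finally show ?thesis ..
qed

lemma normal_or_t_symmetric_distribution:
  "real_distribution (normal_or_t c)" "distr (normal_or_t c) borel uminus = normal_or_t c"
  by (cases c; simp add: normal_or_t_def real_dist_normal_dist real_distribution_student_t
      std_normal_symmetric student_t_symmetric)+

section \<open>Independence of transformed variables\<close>

lemma (in prob_space) indep_set_commute: "indep_set A B \<Longrightarrow> indep_set B A"
  unfolding indep_sets2_eq by (metis Int_commute mult.commute)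

text \<open>Returns to the library notion once both variables are mapped into one value type.
  Preimages under a composition are among the preimages under the inner map, so independence is
  inherited; \<open>indep_var\<close> speaks of generated sigma-algebras, which are reached because
  families of preimages are stable under intersection.\<close>

lemma indep_rv_imp_indep_var:
  assumes P: "prob_space P" and ind: "indep_rv P S A T B"
    and f: "f \<in> measurable S S'" and g: "g \<in> measurable T T'"
  shows "prob_space.indep_var P S' (\<lambda>w. f (A w)) T' (\<lambda>w. g (B w))"
proof -
  interpret prob_space P by fact
  have A: "A \<in> measurable P S" and B: "B \<in> measurable P T"
    and AB: "indep_set {A -` E \<inter> space P | E. E \<in> sets S} {B -` E \<inter> space P | E. E \<in> sets T}"
    using ind by (auto simp: indep_rv_def)
  have stable: "Int_stable {h -` E \<inter> space P | E. E \<in> sets N}" for h :: "'a \<Rightarrow> 'z" and N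
  proof (rule Int_stableI, clarify)
    fix E F assume "E \<in> sets N" "F \<in> sets N"
    then show "\<exists>G. h -` E \<inter> space P \<inter> (h -` F \<inter> space P) = h -` G \<inter> space P \<and> G \<in> sets N"
      by (intro exI[of _ "E \<inter> F"]) auto
  qed
  have sub: "{(\<lambda>w. h (H w)) -` E \<inter> space P | E. E \<in> sets N'} \<subseteq> {H -` E \<inter> space P | E. E \<in> sets N}"
    if "H \<in> measurable P N" "h \<in> measurable N N'" for h :: "'z \<Rightarrow> 'y" and H N N'
  proof clarify
    fix E assume "E \<in> sets N'"
    with that show "\<exists>F. (\<lambda>w. h (H w)) -` E \<inter> space P = H -` F \<inter> space P \<and> F \<in> sets N"
      by (intro exI[of _ "h -` E \<inter> space N"]) (auto dest: measurable_space measurable_sets)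
  qed
  have "indep_set {(\<lambda>w. f (A w)) -` E \<inter> space P | E. E \<in> sets S'}
      {(\<lambda>w. g (B w)) -` E \<inter> space P | E. E \<in> sets T'}"
    unfolding indep_set_def
  proof (rule indep_sets_mono_sets[OF AB[unfolded indep_set_def]])
    fix i :: bool
    show "(case i of True \<Rightarrow> {(\<lambda>w. f (A w)) -` E \<inter> space P | E. E \<in> sets S'}
        | False \<Rightarrow> {(\<lambda>w. g (B w)) -` E \<inter> space P | E. E \<in> sets T'})
      \<subseteq> (case i of True \<Rightarrow> {A -` E \<inter> space P | E. E \<in> sets S}
        | False \<Rightarrow> {B -` E \<inter> space P | E. E \<in> sets T})"
      by (cases i; simp only: bool.case sub[OF A f] sub[OF B g])
  qed
  then have "indep_set (sigma_sets (space P) {(\<lambda>w. f (A w)) -` E \<inter> space P | E. E \<in> sets S'})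
      (sigma_sets (space P) {(\<lambda>w. g (B w)) -` E \<inter> space P | E. E \<in> sets T'})"
    by (rule indep_set_sigma_sets[OF _ stable stable])
  then show ?thesis
    unfolding indep_var_eq using A B f g by (auto intro: measurable_compose)
qed

section \<open>Law of the pivot in the fixed model\<close>

text \<open>The pivot is \<open>Z / sqrt (s\<^sup>2 / \<sigma>\<^sup>2)\<close>, where
  \<open>Z\<close> is the estimation error divided by its true standard deviation
  \<open>\<tau>\<close>. \<open>Z\<close> is standard normal and independent of the variance
  estimator, so the two variance cases yield the normal and the t law.\<close>

lemma pivot_distribution:
  fixes Q :: "((nat \<Rightarrow> real) \<times> real) measure"
  assumes X: "X \<in> carrier_mat n p" and M1: "M1 \<subseteq> {..<p}" "full_column_rank X M1"
    and \<mu>: "\<mu> \<in> carrier_vec n" and \<sigma>: "0 < \<sigma>" and law: "sampling_law X M0 M1 c \<mu> \<sigma> Q"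
  defines "pivot \<equiv> \<lambda>(y, s). (ls_coeff1 X M1 (vec n y) - ls_coeff1 X M1 \<mu>) / std_err1 X M1 s"
  shows "pivot \<in> borel_measurable Q" and "AE (y, s) in Q. 0 < std_err1 X M1 s"
    and "distr Q borel pivot = normal_or_t c"
proof -
  let ?N = std_normal_distribution
  have n: "dim_row X = n" using X by auto
  have Q: "prob_space Q" and setsQ: "sets Q = sets (data_space n)"
    and err: "distr Q (\<Pi>\<^sub>M i\<in>{..<n}. borel) (\<lambda>(y, s). \<lambda>i\<in>{..<n}. y i - vec_index \<mu> i) =
        (\<Pi>\<^sub>M i\<in>{..<n}. density lborel (normal_density 0 \<sigma>))"
    and ind: "indep_rv Q borel (\<lambda>(y, s). s\<^sup>2)
        ((\<Pi>\<^sub>M i\<in>{..<card M0}. borel) \<Otimes>\<^sub>M (\<Pi>\<^sub>M i\<in>{..<card M1}. borel))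
        (\<lambda>(y, s). (coords (ls_coeff X M0 (vec n y)), coords (ls_coeff X M1 (vec n y))))"
    and var: "case c of Known_Variance \<Rightarrow> (AE (y, s) in Q. s\<^sup>2 = \<sigma>\<^sup>2)
       | Unknown_Variance r \<Rightarrow> 1 \<le> r \<and>
           distr Q borel (\<lambda>(y, s). s\<^sup>2) = distr (chi_square r) borel (\<lambda>v. \<sigma>\<^sup>2 * v / real r)"
    using law unfolding sampling_law_def Let_def n by auto
  interpret prob_space Q by (rule Q)
  note [measurable_cong] = setsQ[unfolded data_space_def]
  obtain a where a: "\<And>v. v \<in> carrier_vec n \<Longrightarrow> ls_coeff1 X M1 v = (\<Sum>i<n. a i * vec_index v i)"
    and a2: "(\<Sum>i<n. (a i)\<^sup>2) = inv_gram X M1 $$ (0, 0)" and d: "inv_gram X M1 $$ (0, 0) > 0"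
    using ls_coeff1_linear[OF X M1] by blast
  define \<tau> where "\<tau> = \<sigma> * sqrt (inv_gram X M1 $$ (0, 0))"
  have \<tau>: "0 < \<tau>" using \<sigma> d by (simp add: \<tau>_def)
  have se: "std_err1 X M1 s = \<tau> * sqrt (s\<^sup>2 / \<sigma>\<^sup>2)" for s
    using \<sigma> by (simp add: std_err1_def \<tau>_def real_sqrt_mult real_sqrt_divide)
  define Z where "Z = (\<lambda>w :: (nat \<Rightarrow> real) \<times> real. (ls_coeff1 X M1 (vec n (fst w)) - ls_coeff1 X M1 \<mu>) / \<tau>)"
  \<comment> \<open>The target is the same linear functional applied to \<mu>, so the difference is
    linear in the error alone, wherever \<mu> lies.\<close>
  have Z_eq: "Z w = (\<Sum>i<n. a i / \<tau> * (fst w i - vec_index \<mu> i))" for w :: "(nat \<Rightarrow> real) \<times> real"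
    using \<mu> by (simp add: Z_def a sum_subtractf[symmetric] sum_divide_distrib right_diff_distrib diff_divide_distrib)
  have [measurable]: "Z \<in> borel_measurable Q"
    unfolding Z_eq[abs_def] by measurable
  have piv: "pivot = (\<lambda>w. Z w / sqrt ((snd w)\<^sup>2 / \<sigma>\<^sup>2))"
    by (auto simp: pivot_def Z_def se)
  show meas: "pivot \<in> borel_measurable Q" unfolding piv by measurable

  \<comment> \<open>These weights turn errors of standard deviation \<sigma> into a combination of
    standard deviation 1.\<close>
  have coeffs: "(\<Sum>i<n. (a i / \<tau>)\<^sup>2) = 1 / \<sigma>\<^sup>2"
    using \<sigma> d by (simp add: power_divide sum_divide_distrib[symmetric] a2 \<tau>_def power_mult_distrib)
  have "distr Q borel Z =
      distr (distr Q (\<Pi>\<^sub>M i\<in>{..<n}. borel) (\<lambda>(y, s). \<lambda>i\<in>{..<n}. y i - vec_index \<mu> i)) borel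
        (\<lambda>u. \<Sum>i<n. a i / \<tau> * u i)"
    by (subst distr_distr) (auto simp: comp_def case_prod_unfold Z_eq[abs_def])
  also have "\<dots> = ?N"
    unfolding err using \<sigma>
    by (subst distr_linear_combination_normal) (simp_all add: coeffs real_sqrt_divide)
  finally have Z_normal: "distr Q borel Z = ?N" .

  \<comment> \<open>\<open>Z\<close> is a function of component 0 of the coefficient vector in
    \<open>M1\<close>, the form in which the sampling law asserts independence.\<close>
  have "indep_var borel (\<lambda>w. case w of (y, s) \<Rightarrow> s\<^sup>2) borel
      (\<lambda>w. (snd (case w of (y, s) \<Rightarrow>
        (coords (ls_coeff X M0 (vec n y)), coords (ls_coeff X M1 (vec n y)))) 0 - ls_coeff1 X M1 \<mu>) / \<tau>)"
  proof (rule indep_rv_imp_indep_var[OF Q ind])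
    have "0 \<in> {..<card M1}" using M1(2) by (simp add: full_column_rank_def)
    then have "(\<lambda>e. snd e 0) \<in> borel_measurable
        ((\<Pi>\<^sub>M i\<in>{..<card M0}. borel :: real measure) \<Otimes>\<^sub>M (\<Pi>\<^sub>M i\<in>{..<card M1}. borel :: real measure))"
      by (rule measurable_compose[OF measurable_snd measurable_component_singleton])
    then show "(\<lambda>e. (snd e 0 - ls_coeff1 X M1 \<mu>) / \<tau>) \<in> borel_measurable
        ((\<Pi>\<^sub>M i\<in>{..<card M0}. borel :: real measure) \<Otimes>\<^sub>M (\<Pi>\<^sub>M i\<in>{..<card M1}. borel :: real measure))"
      by simp
  qed simp
  \<comment> \<open>\<open>coords\<close> is \<open>undefined\<close> beyond the dimension; here the
    dimension is \<open>card M1\<close>, which is at least 1.\<close>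
  moreover have "coords (ls_coeff X M1 v) 0 = ls_coeff1 X M1 v" for v
    using inv_gram_inverse(1)[OF X M1] M1(2)
    by (simp add: coords_def ls_coeff1_def ls_coeff_def full_column_rank_def)
  ultimately have "indep_var borel (\<lambda>w. (snd w)\<^sup>2) borel Z"
    by (simp add: case_prod_unfold Z_def)
  then have "indep_var borel Z borel (\<lambda>w. (snd w)\<^sup>2)"
    unfolding indep_var_eq using indep_set_commute by blast
  then have joint: "distr Q (borel \<Otimes>\<^sub>M borel) (\<lambda>w. (Z w, (snd w)\<^sup>2)) =
      ?N \<Otimes>\<^sub>M distr Q borel (\<lambda>w. (snd w)\<^sup>2)"
    by (simp add: indep_var_distribution_eq Z_normal)

  \<comment> \<open>Positivity and law are shown together because both depend on the variance
    case.\<close>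
  have "(AE w in Q. 0 < (snd w)\<^sup>2) \<and> distr Q borel pivot = normal_or_t c"
  proof (cases c)
    case Known_Variance
    then have s: "AE w in Q. (snd w)\<^sup>2 = \<sigma>\<^sup>2" using var by (simp add: case_prod_unfold)
    then have "AE w in Q. pivot w = Z w"
      by eventually_elim (use \<sigma> in \<open>simp add: piv\<close>)
    then have "distr Q borel pivot = distr Q borel Z"
      by (intro distr_cong_AE) (simp_all add: meas)
    moreover from s have "AE w in Q. 0 < (snd w)\<^sup>2"
      by eventually_elim (use \<sigma> in simp)
    ultimately show ?thesis using Z_normal by (simp add: Known_Variance normal_or_t_def)
  next
    case (Unknown_Variance r)
    let ?C = "chi_square r"
    have r: "1 \<le> r" and s: "distr Q borel (\<lambda>w. (snd w)\<^sup>2) = distr ?C borel (\<lambda>v. \<sigma>\<^sup>2 * v / real r)"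
      using var by (simp_all add: Unknown_Variance case_prod_unfold)
    \<comment> \<open>Positivity is a property of the law of the squared estimator, so it transfers
      from chi-square to \<open>Q\<close>.\<close>
    have "AE t in distr ?C borel (\<lambda>v. \<sigma>\<^sup>2 * v / real r). 0 < t"
      using AE_chi_square_pos[OF r] \<sigma> r by (subst AE_distr_iff) auto
    then have pos: "AE w in Q. 0 < (snd w)\<^sup>2"
      unfolding s[symmetric] by (subst (asm) AE_distr_iff) simp_all
    have "?N \<Otimes>\<^sub>M distr ?C borel (\<lambda>v. \<sigma>\<^sup>2 * v / real r) =
        distr ?N borel (\<lambda>z. z) \<Otimes>\<^sub>M distr ?C borel (\<lambda>v. \<sigma>\<^sup>2 * v / real r)"
      by (simp add: distr_id2)
    also have "\<dots> = distr (?N \<Otimes>\<^sub>M ?C) (borel \<Otimes>\<^sub>M borel) (\<lambda>(z, v). (z, \<sigma>\<^sup>2 * v / real r))"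
      by (rule pair_measure_distr)
         (auto intro!: prob_space_imp_sigma_finite prob_space.prob_space_distr prob_space_chi_square)
    finally have joint': "distr Q (borel \<Otimes>\<^sub>M borel) (\<lambda>w. (Z w, (snd w)\<^sup>2)) =
        distr (?N \<Otimes>\<^sub>M ?C) (borel \<Otimes>\<^sub>M borel) (\<lambda>(z, v). (z, \<sigma>\<^sup>2 * v / real r))"
      by (simp add: joint s)
    \<comment> \<open>Dividing by \<open>\<sigma>\<^sup>2\<close> cancels the scale of the variance
      estimator and leaves the quotient that defines \<open>student_t\<close>.\<close>
    have "distr Q borel pivot =
        distr (distr Q (borel \<Otimes>\<^sub>M borel) (\<lambda>w. (Z w, (snd w)\<^sup>2))) borel (\<lambda>(z, t). z / sqrt (t / \<sigma>\<^sup>2))"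
      by (subst distr_distr) (auto simp: comp_def piv)
    also have "\<dots> = student_t r"
      unfolding joint' student_t_def using \<sigma>
      by (subst distr_distr) (auto simp: comp_def case_prod_unfold)
    finally show ?thesis using pos by (simp add: Unknown_Variance normal_or_t_def)
  qed
  then show "distr Q borel pivot = normal_or_t c" and "AE (y, s) in Q. 0 < std_err1 X M1 s"
    using \<tau> \<sigma> by (auto simp: se case_prod_unfold)
qed

section \<open>Coverage after selection\<close>

theorem mainTheorem2:
  fixes X :: "real mat" and n p :: nat and M0 M1 :: "nat set" and c :: variance_case
    and P :: "real vec \<Rightarrow> real \<Rightarrow> ((nat \<Rightarrow> real) \<times> real) measure"
    and sel :: "(nat \<Rightarrow> real) \<times> real \<Rightarrow> nat set"
    and \<alpha> k\<^sub>N :: real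
  assumes X: "X \<in> carrier_mat n p"
    and M0: "M0 \<subseteq> {..<p}" "full_column_rank X M0" "0 \<notin> M0"
    and M1: "M1 \<subseteq> {..<p}" "full_column_rank X M1" "0 \<in> M1"
    and P: "\<And>\<mu> \<sigma>. \<mu> \<in> carrier_vec n \<Longrightarrow> 0 < \<sigma> \<Longrightarrow> sampling_law X M0 M1 c \<mu> \<sigma> (P \<mu> \<sigma>)"
    and sel: "sel \<in> measurable (data_space n) (count_space {M0, M1})"
    and \<alpha>: "0 < \<alpha>" "\<alpha> < 1"
    and k\<^sub>N: "k\<^sub>N = quantile (normal_or_t c) (1 - \<alpha> / 2)"
  shows "\<forall>\<mu> \<in> carrier_vec n. \<forall>\<sigma> > 0.
    measure (P \<mu> \<sigma>) {(y, s) \<in> space (P \<mu> \<sigma>).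
      target X M1 \<mu> (sel (y, s)) \<in> post_interval X M1 k\<^sub>N (vec n y) s (sel (y, s))} \<ge> 1 - \<alpha>"
proof (intro ballI allI impI)
  fix \<mu> :: "real vec" and \<sigma> :: real
  assume \<mu>: "\<mu> \<in> carrier_vec n" and \<sigma>: "0 < \<sigma>"
  let ?Q = "P \<mu> \<sigma>" and ?N = "normal_or_t c"
  let ?pivot = "\<lambda>(y, s). (ls_coeff1 X M1 (vec n y) - ls_coeff1 X M1 \<mu>) / std_err1 X M1 s"
  let ?E = "{(y, s) \<in> space ?Q.
      target X M1 \<mu> (sel (y, s)) \<in> post_interval X M1 k\<^sub>N (vec n y) s (sel (y, s))}"
  have law: "sampling_law X M0 M1 c \<mu> \<sigma> ?Q" by (rule P) fact+
  then have Q: "prob_space ?Q" and setsQ: "sets ?Q = sets (data_space n)"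
    using X by (auto simp: sampling_law_def Let_def)
  interpret prob_space ?Q by (rule Q)
  note piv = pivot_distribution[OF X M1(1,2) \<mu> \<sigma> law]
  have [measurable]: "sel \<in> measurable ?Q (count_space {M0, M1})"
    using sel setsQ by (simp cong: measurable_cong_sets)
  \<comment> \<open>A finite sum over coordinates makes the measurability of the estimator
    evident.\<close>
  obtain a where a: "\<And>v. v \<in> carrier_vec n \<Longrightarrow> ls_coeff1 X M1 v = (\<Sum>i<n. a i * vec_index v i)"
    using ls_coeff1_linear[OF X M1(1,2)] by blast
  have coord: "(\<lambda>w. ls_coeff1 X M1 (vec n (fst w))) \<in> borel_measurable ?Q"
  proof -
    note [measurable_cong] = setsQ[unfolded data_space_def]
    show ?thesis by (simp add: a)
  qed
  have err: "(\<lambda>w. std_err1 X M1 (snd w)) \<in> borel_measurable ?Q"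
  proof -
    note [measurable_cong] = setsQ[unfolded data_space_def]
    show ?thesis unfolding std_err1_def by measurable
  qed
  \<comment> \<open>If \<open>M1\<close> is not selected, membership reads 0 in {0}, so only an
    implication remains. Measurability must be checked because \<open>measure\<close> is 0 on
    nonmeasurable sets.\<close>
  have "?E = {w \<in> space ?Q. sel w = M1 \<longrightarrow>
      ls_coeff1 X M1 (vec n (fst w)) - k\<^sub>N * std_err1 X M1 (snd w) \<le> ls_coeff1 X M1 \<mu> \<and>
      ls_coeff1 X M1 \<mu> \<le> ls_coeff1 X M1 (vec n (fst w)) + k\<^sub>N * std_err1 X M1 (snd w)}"
    by (auto simp: target_def post_interval_def naive_interval_def)
  also have "\<dots> \<in> sets ?Q" using coord err by measurable
  finally have E: "?E \<in> sets ?Q" .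
  have "1 - \<alpha> \<le> measure ?N {x. \<bar>x\<bar> \<le> k\<^sub>N}"
    unfolding k\<^sub>N by (intro symmetric_quantile_coverage normal_or_t_symmetric_distribution \<alpha>)
  also have "\<dots> = measure ?Q {w \<in> space ?Q. \<bar>?pivot w\<bar> \<le> k\<^sub>N}"
    unfolding piv(3)[symmetric] using piv(1)
    by (subst measure_distr) (auto intro!: arg_cong[where f="measure ?Q"])
  also have "\<dots> \<le> measure ?Q ?E"
  proof (rule finite_measure_mono_AE[OF _ E])
    \<comment> \<open>Where the standard error is positive, the pivot bound can be multiplied out to
      the interval. At standard error 0 the pivot would be 0 by the convention for division and say
      nothing about coverage; this happens with probability 0.\<close>
    show "AE w in ?Q. w \<in> {w \<in> space ?Q. \<bar>?pivot w\<bar> \<le> k\<^sub>N} \<longrightarrow> w \<in> ?E"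
      using piv(2)
    proof eventually_elim
      case (elim w)
      then show ?case
        by (auto simp: target_def post_interval_def naive_interval_def abs_le_iff field_simps)
    qed
  qed
  finally show "1 - \<alpha> \<le> measure ?Q ?E" .
qed

end
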